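(* Let $T$ be the Takagi function and for $y\in\mathbb{R}$ let $L(y)=\{x\in[0,1]:T(x)=y\}$ be the level set of $T$ at level $y$. Every uncountable level set contains an uncountable local level set; that is, if $y\in\mathbb{R}$ and $L(y)$ is uncountable, then there exists $x\in[0,1)$ such that the local level set $L_x^{loc}$ is uncountable and $L_x^{loc}\subset L(y)$.
   Context: The Takagi function is $T(x)=\sum_{n=0}^\infty \frac{1}{2^n}\phi(2^n x)$, where $\phi(x)=\operatorname{dist}(x,\mathbb{Z})$ is the distance from $x$ to the nearest integer. For $x\in[0,1)$ write the binary expansion $x=\sum_{n=1}^\infty \varepsilon_n/2^n$ with $\varepsilon_n\in\{0,1\}$, choosing the representation ending in all zeros if $x$ is a dyadic rational. For integers $k\ge 0$ put $D_k(x):=\sum_{j=1}^k(-1)^{\varepsilon_j}$. Define an equivalence relation on $[0,1)$ by $x\sim x'$ if and only if $|D_j(x)|=|D_j(x')|$ for every $j\in\mathbb{N}=\{1,2,\dots\}$. The local level set containing $x\in[0,1)$ is $L_x^{loc}:=\{x'\in[0,1): x'\sim x\}$. It is known that $x\sim x'$ implies $T(x)=T(x')$, so that each local level set is a subset of a level set. *)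

theory Defs
  imports "HOL-Analysis.Analysis"
begin

definition dist_to_int :: "real \<Rightarrow> real" where
  "dist_to_int x = infdist x \<int>"

definition takagi :: "real \<Rightarrow> real" where
  "takagi x = (\<Sum>n. dist_to_int (2 ^ n * x) / 2 ^ n)"

definition takagi_level_set :: "real \<Rightarrow> real set" where
  "takagi_level_set y = {x \<in> {0..1}. takagi x = y}"

text \<open>
  Digits are indexed from 1; the value \<open>e 0\<close> is irrelevant and left unconstrained.
  The library set \<^const>\<open>dyadics\<close> consists of the nonnegative dyadic rationals, which are
  the only ones relevant for points of \<open>[0,1)\<close>.
\<close>

definition binary_expansion :: "real \<Rightarrow> (nat \<Rightarrow> nat) \<Rightarrow> bool" where
  "binary_expansion x e \<longleftrightarrow>
     (\<forall>n\<ge>1. e n \<in> {0, 1}) \<and>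
     (\<lambda>n. real (e (Suc n)) / 2 ^ Suc n) sums x \<and>
     (x \<in> dyadics \<longrightarrow> (\<exists>N. \<forall>n\<ge>N. e n = 0))"

text \<open>
  For \<open>x\<close> in \<open>[0,1)\<close> such a digit sequence exists and is unique at all indices \<open>n \<ge> 1\<close>;
  see \<open>binary_expansion_exists\<close> and \<open>binary_expansion_unique\<close> below.
\<close>

definition binary_digit :: "real \<Rightarrow> nat \<Rightarrow> nat" where
  "binary_digit x = (SOME e. binary_expansion x e)"

definition digit_walk :: "nat \<Rightarrow> real \<Rightarrow> int" where
  "digit_walk k x = (\<Sum>j=1..k. (- 1) ^ binary_digit x j)"

definition takagi_equiv :: "real \<Rightarrow> real \<Rightarrow> bool" where
  "takagi_equiv x x' \<longleftrightarrow> (\<forall>j\<ge>1. \<bar>digit_walk j x\<bar> = \<bar>digit_walk j x'\<bar>)"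

definition local_level_set :: "real \<Rightarrow> real set" where
  "local_level_set x = {x' \<in> {0..<1}. takagi_equiv x' x}"

lemma binary_expansion_exists:
  assumes x: "x \<in> {0..<1}"
  shows "\<exists>e. binary_expansion x e"
proof -
  define e where "e n = nat (\<lfloor>2 ^ n * x\<rfloor> mod 2)" for n :: nat
  have dbl: "\<lfloor>2 ^ Suc n * x\<rfloor> = 2 * \<lfloor>2 ^ n * x\<rfloor> + int (e (Suc n))" for n
  proof -
    have *: "2 ^ Suc n * x = 2 * (2 ^ n * x)" by simp
    have "\<lfloor>2 * (2 ^ n * x)\<rfloor> = 2 * \<lfloor>2 ^ n * x\<rfloor> \<or> \<lfloor>2 * (2 ^ n * x)\<rfloor> = 2 * \<lfloor>2 ^ n * x\<rfloor> + 1"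
      by linarith
    then show ?thesis unfolding e_def * by auto
  qed
  have S: "(\<Sum>j<n. real (e (Suc j)) / 2 ^ Suc j) = of_int \<lfloor>2 ^ n * x\<rfloor> / 2 ^ n" for n
  proof (induction n)
    case 0
    have "\<lfloor>x\<rfloor> = 0" using x by (simp add: floor_eq_iff)
    then show ?case by simp
  next
    case (Suc n)
    have "real_of_int \<lfloor>2 ^ Suc n * x\<rfloor> = 2 * real_of_int \<lfloor>2 ^ n * x\<rfloor> + real (e (Suc n))"
      unfolding dbl by simp
    then show ?case using Suc.IH by (simp add: field_simps)
  qed
  have "(\<lambda>n. of_int \<lfloor>2 ^ n * x\<rfloor> / 2 ^ n) \<longlonglongrightarrow> x"
  proof (rule tendsto_sandwich[of "\<lambda>n. x - (1/2) ^ n" _ _ "\<lambda>_. x"])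
    have "x - (1/2) ^ n \<le> of_int \<lfloor>2 ^ n * x\<rfloor> / 2 ^ n" for n
    proof -
      have "2 ^ n * x - 1 \<le> of_int \<lfloor>2 ^ n * x\<rfloor>" by linarith
      then have "(2 ^ n * x - 1) / 2 ^ n \<le> of_int \<lfloor>2 ^ n * x\<rfloor> / 2 ^ n"
        by (rule divide_right_mono) simp
      then show ?thesis by (simp add: diff_divide_distrib power_one_over)
    qed
    then show "\<forall>\<^sub>F n in sequentially. x - (1/2) ^ n \<le> of_int \<lfloor>2 ^ n * x\<rfloor> / 2 ^ n" by simp
    have "of_int \<lfloor>2 ^ n * x\<rfloor> / 2 ^ n \<le> x" for n
      by (simp add: pos_divide_le_eq mult.commute)
    then show "\<forall>\<^sub>F n in sequentially. of_int \<lfloor>2 ^ n * x\<rfloor> / 2 ^ n \<le> x" by simp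
    have "(\<lambda>n. x - (1/2) ^ n) \<longlonglongrightarrow> x - 0"
      by (intro tendsto_diff tendsto_const LIMSEQ_realpow_zero) auto
    then show "(\<lambda>n. x - (1/2) ^ n) \<longlonglongrightarrow> x" by simp
  qed simp
  then have sums: "(\<lambda>n. real (e (Suc n)) / 2 ^ Suc n) sums x"
    unfolding sums_def S .
  have "\<exists>N. \<forall>n\<ge>N. e n = 0" if "x \<in> dyadics"
  proof -
    from that obtain k m :: nat where xm: "x = of_nat m / 2 ^ k"
      by (auto simp: dyadics_def)
    have "e n = 0" if n: "n \<ge> Suc k" for n
    proof -
      obtain d where d: "n = Suc k + d" using le_Suc_ex[OF n] by blast
      have "2 ^ n * x = of_int (2 * (2 ^ d * int m))" by (simp add: xm d power_add)
      then have "\<lfloor>2 ^ n * x\<rfloor> = 2 * (2 ^ d * int m)" by (simp only: floor_of_int)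
      then show ?thesis by (simp add: e_def)
    qed
    then show ?thesis by blast
  qed
  moreover have "e n \<in> {0, 1}" for n by (auto simp: e_def)
  ultimately show ?thesis using sums unfolding binary_expansion_def by blast
qed

lemma binary_expansion_floor:
  assumes x: "x \<in> {0..<1}" and e: "binary_expansion x e" and n: "n \<ge> 1"
  shows "int (e n) = \<lfloor>2 ^ n * x\<rfloor> mod 2"
proof -
  define S where "S n = (\<Sum>j<n. real (e (Suc j)) / 2 ^ Suc j)" for n
  have e01: "e (Suc n) = 0 \<or> e (Suc n) = 1" for n
    using e by (auto simp: binary_expansion_def)
  have lim: "S \<longlonglongrightarrow> x"
    using e unfolding binary_expansion_def sums_def S_def by blast
  have S_Suc: "S (Suc n) = S n + real (e (Suc n)) / 2 ^ Suc n" for n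
    by (simp add: S_def)
  define R where "R n = 2 ^ n * (x - S n)" for n
  have R_Suc: "R (Suc n) = 2 * R n - real (e (Suc n))" for n
    by (simp add: R_def S_Suc field_simps)
  have R0: "R n \<ge> 0" for n
  proof -
    have "incseq S" by (rule incseq_SucI) (simp add: S_Suc)
    then have "S n \<le> x" using lim by (rule incseq_le)
    then show ?thesis by (simp add: R_def)
  qed
  have R1: "R n \<le> 1" for n
  proof -
    have "decseq (\<lambda>n. S n + (1/2) ^ n)"
    proof (rule decseq_SucI)
      show "S (Suc n) + (1/2) ^ Suc n \<le> S n + (1/2) ^ n" for n
        using e01[of n] by (auto simp: S_Suc field_simps)
    qed
    moreover have "(\<lambda>n. S n + (1/2) ^ n) \<longlonglongrightarrow> x + 0"
      by (intro tendsto_add lim LIMSEQ_realpow_zero) auto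
    ultimately have "x \<le> S n + (1/2) ^ n" using decseq_ge by force
    then have "2 ^ n * (x - S n) \<le> 2 ^ n * (1/2) ^ n" by simp
    then show ?thesis by (simp add: R_def power_one_over)
  qed
  have N: "\<exists>N::nat. 2 ^ n * S n = real N" for n
  proof (induction n)
    case 0
    show ?case by (simp add: S_def)
  next
    case (Suc n)
    then obtain N where "2 ^ n * S n = real N" by blast
    then have "2 ^ Suc n * S (Suc n) = real (2 * N + e (Suc n))"
      by (simp add: S_Suc field_simps)
    then show ?case by blast
  qed
  have R_less: "R n < 1" for n
  proof (rule ccontr)
    assume "\<not> R n < 1"
    then have Rn: "R n = 1" using R1[of n] by simp
    have step: "R (Suc k) = 1 \<and> e (Suc k) = 1" if "R k = 1" for k
      using that R1[of "Suc k"] R_Suc[of k] e01[of k] by auto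
    have Rk: "R (n + k) = 1" for k
      by (induction k) (use Rn step in auto)
    obtain N where "2 ^ n * S n = real N" using N by blast
    then have "x = of_nat (N + 1) / 2 ^ n"
      using Rn by (simp add: R_def field_simps)
    then have "x \<in> dyadics" unfolding dyadics_def by blast
    then obtain M where "\<forall>k\<ge>M. e k = 0" using e unfolding binary_expansion_def by blast
    then have "e (Suc (n + M)) = 0" by simp
    then show False using step[OF Rk] by simp
  qed
  obtain m where m: "n = Suc m" using n by (cases n) auto
  obtain N where N': "2 ^ m * S m = real N" using N by blast
  have "2 ^ n * S n = real (2 * N + e n)"
    using N' by (simp add: m S_Suc field_simps)
  then have "2 ^ n * x = of_int (int (2 * N + e n)) + R n"
    by (simp add: R_def algebra_simps)
  then have "\<lfloor>2 ^ n * x\<rfloor> = int (2 * N + e n)"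
    using R0[of n] R_less[of n] by linarith
  then show ?thesis using e01[of m] m by auto
qed

lemma binary_expansion_unique:
  assumes "x \<in> {0..<1}" "binary_expansion x e" "binary_expansion x e'" "n \<ge> 1"
  shows "e n = e' n"
  using binary_expansion_floor[OF assms(1,2,4)] binary_expansion_floor[OF assms(1,3,4)] by simp

lemma binary_expansion_binary_digit:
  "x \<in> {0..<1} \<Longrightarrow> binary_expansion x (binary_digit x)"
  unfolding binary_digit_def using binary_expansion_exists by (rule someI_ex)

end

theory Submission
  imports Defs
begin

text \<open>
  Write \<open>D\<^sub>n\<close> for the walk of \<open>x\<close> and \<open>v\<^sub>n\<close> for the fractional part of \<open>2\<^sup>n x\<close>. On a dyadic interval
  of order \<open>n\<close> the Takagi function is, up to a constant, a copy of \<open>T(v) + D\<^sub>n v\<close> scaled by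
  \<open>2\<^sup>-\<^sup>n\<close>. If the walk never returns to zero after time \<open>0\<close>, say \<open>D\<^sub>n \<ge> 1\<close> for all \<open>n \<ge> 1\<close>, then
  \<open>T(v\<^sub>n) + D\<^sub>n v\<^sub>n\<close> lies between \<open>0\<close> and \<open>D\<^sub>n\<close>, and these bounds make \<open>T\<close> strictly increasing on
  the nondyadic points of this kind. Hence a nondyadic point of a level set whose last return to
  zero is at time \<open>n\<close> is determined by its first \<open>n + 1\<close> digits, and an uncountable level set
  contains a point whose walk returns to zero infinitely often. The excursions of that walk can be
  reflected independently of each other, which yields one point of the local level set for every
  set of return times.
\<close>

section \<open>Functional equations of the Takagi function\<close>

lemma dist_to_int_bounds: "0 \<le> dist_to_int x" "dist_to_int x \<le> 1 / 2"
proof -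
  show "0 \<le> dist_to_int x"
    by (simp add: dist_to_int_def infdist_nonneg)
  have "of_int (round x) \<in> (\<int> :: real set)"
    by simp
  then have "dist_to_int x \<le> dist x (of_int (round x))"
    unfolding dist_to_int_def by (rule infdist_le)
  also have "\<dots> \<le> 1 / 2"
    using of_int_round_abs_le[of x] by (simp add: dist_real_def abs_minus_commute)
  finally show "dist_to_int x \<le> 1 / 2" .
qed

lemma dist_to_int_add_int: "dist_to_int (of_int k + x) = dist_to_int x"
proof -
  \<comment> \<open>One inequality for all \<open>k\<close> suffices: applied to \<open>- k\<close>
    it yields the converse.\<close>
  have le: "dist_to_int (of_int k + x) \<le> dist_to_int x" for k and x :: real
  proof -
    have "infdist (of_int k + x) \<int> \<le> dist x a" if "a \<in> \<int>" for a
    proof -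
      have "infdist (of_int k + x) \<int> \<le> dist (of_int k + x) (of_int k + a)"
        using that by (intro infdist_le) auto
      then show ?thesis by simp
    qed
    moreover have "(\<int> :: real set) \<noteq> {}"
      using Ints_0 by blast
    ultimately show ?thesis
      unfolding dist_to_int_def infdist_notempty[OF \<open>\<int> \<noteq> {}\<close>, of x]
      by (intro cINF_greatest) auto
  qed
  have "dist_to_int x = dist_to_int (of_int (- k) + (of_int k + x))"
    by simp
  then show ?thesis
    using le[of k x] le[of "- k" "of_int k + x"] by linarith
qed

lemma dist_to_int_unit_interval:
  assumes "x \<in> {0..1}"
  shows "dist_to_int x = min x (1 - x)"
proof (rule antisym)
  have "infdist x \<int> \<le> dist x 0" "infdist x \<int> \<le> dist x 1"
    by (rule infdist_le; simp)+
  then show "dist_to_int x \<le> min x (1 - x)"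
    using assms by (simp add: dist_to_int_def dist_real_def)
  have ne: "(\<int> :: real set) \<noteq> {}"
    using Ints_0 by blast
  have "min x (1 - x) \<le> dist x a" if "a \<in> \<int>" for a
  proof -
    obtain k where k: "a = of_int k"
      using \<open>a \<in> \<int>\<close> by (rule Ints_cases)
    have "a \<le> 0 \<or> 1 \<le> a"
      unfolding k by (cases "k \<le> 0") auto
    then show ?thesis
      using assms by (auto simp: dist_real_def)
  qed
  then show "min x (1 - x) \<le> dist_to_int x"
    unfolding dist_to_int_def infdist_notempty[OF ne]
    by (intro cINF_greatest ne)
qed

lemma takagi_term_bounds:
  "0 \<le> dist_to_int (2 ^ n * x) / 2 ^ n"
  "dist_to_int (2 ^ n * x) / 2 ^ n \<le> (1 / 2) ^ Suc n"
  using dist_to_int_bounds[of "2 ^ n * x"] by (auto simp: field_simps)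

lemma summable_takagi: "summable (\<lambda>n. dist_to_int (2 ^ n * x) / 2 ^ n)"
proof (rule summable_comparison_test')
  show "summable (\<lambda>n. (1 / 2 :: real) ^ Suc n)"
    using power_half_series by (rule sums_summable)
  show "norm (dist_to_int (2 ^ n * x) / 2 ^ n) \<le> (1 / 2) ^ Suc n" if "n \<ge> 0" for n
    unfolding real_norm_def abs_of_nonneg[OF takagi_term_bounds(1)]
    by (rule takagi_term_bounds)
qed

lemma takagi_bounds: "0 \<le> takagi x" "takagi x \<le> 1"
proof -
  show "0 \<le> takagi x"
    unfolding takagi_def by (intro suminf_nonneg summable_takagi takagi_term_bounds)
  have "takagi x \<le> (\<Sum>n. (1 / 2) ^ Suc n)"
    unfolding takagi_def
    by (intro suminf_le summable_takagi takagi_term_bounds sums_summable[OF power_half_series])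
  then show "takagi x \<le> 1"
    using sums_unique[OF power_half_series] by simp
qed

lemma takagi_double: "takagi x = dist_to_int x + takagi (2 * x) / 2"
proof -
  have "takagi x = (\<Sum>n. dist_to_int (2 ^ Suc n * x) / 2 ^ Suc n) + dist_to_int x"
    unfolding takagi_def using suminf_split_head[OF summable_takagi[of x]] by simp
  also have "(\<Sum>n. dist_to_int (2 ^ Suc n * x) / 2 ^ Suc n)
      = (\<Sum>n. (dist_to_int (2 ^ n * (2 * x)) / 2 ^ n) / 2)"
    by (simp add: mult_ac)
  also have "\<dots> = takagi (2 * x) / 2"
    unfolding takagi_def by (rule suminf_divide[OF summable_takagi])
  finally show ?thesis by simp
qed

lemma takagi_add_int: "takagi (of_int k + x) = takagi x"
proof -
  have "dist_to_int (2 ^ n * (of_int k + x)) = dist_to_int (2 ^ n * x)" for n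
    using dist_to_int_add_int[of "2 ^ n * k" "2 ^ n * x"] by (simp add: distrib_left)
  then show ?thesis
    by (simp add: takagi_def)
qed


section \<open>Orbits of the doubling map and their walks\<close>

text \<open>
  Both \<open>v n = 0\<close> and \<open>v n = 1\<close> are admitted, so that the notion is invariant under
  \<open>v \<mapsto> 1 - v\<close>; the digit \<open>e n\<close> is \<open>\<epsilon>\<^sub>n\<^sub>+\<^sub>1\<close> of \<open>v 0\<close>.
\<close>

definition binary_orbit :: "(nat \<Rightarrow> real) \<Rightarrow> (nat \<Rightarrow> nat) \<Rightarrow> bool" where
  "binary_orbit v e \<longleftrightarrow>
     (\<forall>n. v n \<in> {0..1} \<and> e n \<in> {0, 1} \<and> 2 * v n = real (e n) + v (Suc n))"

definition walk :: "(nat \<Rightarrow> nat) \<Rightarrow> nat \<Rightarrow> int" where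
  "walk e n = (\<Sum>j<n. (- 1) ^ e j)"

text \<open>The slope \<open>walk e n\<close> is that of the sum of the first \<open>n\<close> terms
  of the series on the dyadic interval cut out by the first \<open>n\<close> digits.\<close>

definition tilted_takagi :: "(nat \<Rightarrow> real) \<Rightarrow> (nat \<Rightarrow> nat) \<Rightarrow> nat \<Rightarrow> real" where
  "tilted_takagi v e n = takagi (v n) + of_int (walk e n) * v n"

lemma binary_orbitD:
  assumes "binary_orbit v e"
  shows "0 \<le> v n" "v n \<le> 1" "e n = 0 \<or> e n = 1" "2 * v n = real (e n) + v (Suc n)"
  using assms by (auto simp: binary_orbit_def)

lemma binary_orbit_shift:
  "binary_orbit v e \<Longrightarrow> binary_orbit (\<lambda>k. v (n + k)) (\<lambda>k. e (n + k))"
  by (simp add: binary_orbit_def)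

lemma binary_orbit_reflect:
  assumes "binary_orbit v e"
  shows "binary_orbit (\<lambda>k. 1 - v k) (\<lambda>k. 1 - e k)"
  unfolding binary_orbit_def
proof
  fix n
  note o = binary_orbitD[OF assms]
  show "1 - v n \<in> {0..1} \<and> 1 - e n \<in> {0, 1} \<and> 2 * (1 - v n) = real (1 - e n) + (1 - v (Suc n))"
    using o(1,2,3,4)[of n] by auto
qed

lemma walk_0 [simp]: "walk e 0 = 0"
  by (simp add: walk_def)

lemma walk_Suc: "walk e (Suc n) = walk e n + (- 1) ^ e n"
  by (simp add: walk_def)

lemma walk_shift: "walk (\<lambda>k. e (n + k)) k = walk e (n + k) - walk e n"
  by (induction k) (simp_all add: walk_Suc)

lemma walk_reflect:
  assumes "\<And>k. e k = 0 \<or> e k = 1"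
  shows "walk (\<lambda>k. 1 - e k) n = - walk e n"
proof (induction n)
  case (Suc n)
  then show ?case using assms[of n] by (auto simp: walk_Suc)
qed simp

lemma walk_bound: "\<bar>walk e n\<bar> \<le> int n"
proof (induction n)
  case (Suc n)
  have "\<bar>(- 1 :: int) ^ e n\<bar> = 1"
    by (simp add: power_abs)
  then show ?case
    using Suc abs_triangle_ineq[of "walk e n" "(- 1) ^ e n"] by (simp add: walk_Suc)
qed simp

lemma walk_cong:
  assumes "\<And>j. j < n \<Longrightarrow> e j = e' j"
  shows "walk e n = walk e' n"
  using assms by (simp add: walk_def)

text \<open>Steps of size 1 cannot jump over zero, so the first step fixes the sign.\<close>

lemma walk_positive:
  assumes "\<And>k. k \<ge> 1 \<Longrightarrow> walk e k \<noteq> 0" "e 0 = 0" "k \<ge> 1"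
  shows "walk e k \<ge> 1"
  using assms(3)
proof (induction k rule: dec_induct)
  case base
  then show ?case using assms(2) by (simp add: walk_Suc)
next
  case (step k)
  have "(- 1 :: int) ^ e k = 1 \<or> (- 1 :: int) ^ e k = - 1"
    by (metis neg_one_even_power neg_one_odd_power)
  then show ?case
    using step assms(1)[of "Suc k"] by (auto simp: walk_Suc)
qed

text \<open>The digit selects the branch of the tent; at \<open>v n = 1 / 2\<close> both branches
  agree, so either digit is correct there.\<close>

lemma takagi_orbit:
  assumes "binary_orbit v e"
  shows "takagi (v n) = (if e n = 0 then v n else 1 - v n) + takagi (v (Suc n)) / 2"
proof -
  note o = binary_orbitD[OF assms]
  have "takagi (2 * v n) = takagi (v (Suc n))"
    unfolding o(4)[of n] using takagi_add_int[of "int (e n)" "v (Suc n)"] by simp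
  moreover have "dist_to_int (v n) = (if e n = 0 then v n else 1 - v n)"
    using o(1,2)[of n] o(1,2)[of "Suc n"] o(3,4)[of n]
    by (subst dist_to_int_unit_interval) (auto simp: min_def)
  ultimately show ?thesis
    using takagi_double[of "v n"] by simp
qed

lemma tilted_takagi_step:
  assumes "binary_orbit v e"
  shows "tilted_takagi v e n =
    tilted_takagi v e (Suc n) / 2 + real (e n) * (of_int (walk e n) + 1) / 2"
proof -
  note o = binary_orbitD[OF assms]
  have v: "v (Suc n) = 2 * v n - real (e n)"
    using o(4)[of n] by simp
  have T: "takagi (v (Suc n)) = 2 * takagi (v n) - 2 * (if e n = 0 then v n else 1 - v n)"
    using takagi_orbit[OF assms, of n] by simp
  show ?thesis
    using o(3)[of n] unfolding tilted_takagi_def T walk_Suc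
    by (elim disjE) (simp_all add: v field_simps)
qed

text \<open>The inhomogeneous terms of the recursion depend only on the digits, so they cancel along
  a common prefix and each step leaves a factor 1/2.\<close>

lemma tilted_takagi_diff:
  assumes "binary_orbit v e" "binary_orbit v' e'" and eq: "\<And>j. j < n \<Longrightarrow> e j = e' j"
  shows "tilted_takagi v e 0 - tilted_takagi v' e' 0
    = (tilted_takagi v e n - tilted_takagi v' e' n) / 2 ^ n"
  using eq
proof (induction n)
  case (Suc n)
  have "walk e n = walk e' n"
    by (rule walk_cong) (simp add: Suc.prems)
  then have "tilted_takagi v e n - tilted_takagi v' e' n
    = (tilted_takagi v e (Suc n) - tilted_takagi v' e' (Suc n)) / 2"
    using Suc.prems[of n]
    unfolding tilted_takagi_step[OF assms(1), of n] tilted_takagi_step[OF assms(2), of n]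
    by (simp add: field_simps)
  then show ?case using Suc by (simp add: field_simps)
qed simp

text \<open>Iteration gives \<open>g n \<le> g (n + k) / 2 ^ k\<close>, and linear growth loses to
  \<open>2 ^ k\<close>. This is the comparison principle for halving recursions; used in both
  directions it yields equalities.\<close>

lemma nonpos_if_le_half_next:
  fixes g :: "nat \<Rightarrow> real"
  assumes step: "\<And>n. g n \<le> g (Suc n) / 2" and bound: "\<And>n. g n \<le> C * (real n + 1)"
  shows "g n \<le> 0"
proof -
  have iter: "g n \<le> g (n + k) / 2 ^ k" for k
  proof (induction k)
    case (Suc k)
    have "g (n + k) / 2 ^ k \<le> (g (Suc (n + k)) / 2) / 2 ^ k"
      by (intro divide_right_mono step) simp
    then show ?case using Suc by (simp add: field_simps)
  qed simp
  have le: "g n \<le> C * (real n + 1) * (1 / 2) ^ k + C * (real k * (1 / 2) ^ k)" for k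
  proof -
    have "g n \<le> C * (real (n + k) + 1) / 2 ^ k"
      using iter[of k] divide_right_mono[OF bound[of "n + k"], of "2 ^ k"] by simp
    then show ?thesis by (simp add: field_simps)
  qed
  have "(\<lambda>k. C * (real n + 1) * (1 / 2) ^ k + C * (real k * (1 / 2) ^ k))
      \<longlonglongrightarrow> C * (real n + 1) * 0 + C * 0"
    by (intro tendsto_intros LIMSEQ_realpow_zero powser_times_n_limit_0) auto
  then show ?thesis
    using le by (intro tendsto_lowerbound[where F = sequentially]) auto
qed

lemma binary_orbit_unique:
  assumes "binary_orbit v e" "binary_orbit v' e"
  shows "v 0 = v' 0"
proof -
  have le: "u 0 - w 0 \<le> 0" if u: "binary_orbit u e" and w: "binary_orbit w e" for u w
  proof (rule nonpos_if_le_half_next[where g = "\<lambda>n. u n - w n" and C = 1])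
    show "u n - w n \<le> (u (Suc n) - w (Suc n)) / 2" for n
      using binary_orbitD(4)[OF u, of n] binary_orbitD(4)[OF w, of n] by (simp add: field_simps)
    show "u n - w n \<le> 1 * (real n + 1)" for n
      using binary_orbitD(2)[OF u, of n] binary_orbitD(1)[OF w, of n] by simp
  qed
  from le[OF assms] le[OF assms(2,1)] show ?thesis by linarith
qed


section \<open>The Takagi function depends only on the modulus of the walk\<close>

text \<open>
  Centering at \<open>1 / 2\<close> makes the inhomogeneous term a function of \<open>D\<^sub>n\<^sup>2\<close> and \<open>D\<^sub>n\<^sub>+\<^sub>1\<^sup>2\<close>, hence blind
  to the sign of the walk.
\<close>

lemma centered_takagi_step:
  assumes "binary_orbit v e"
  defines "h \<equiv> \<lambda>n. takagi (v n) + of_int (walk e n) * (v n - 1 / 2)"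
  shows "h n = h (Suc n) / 2
    + (3 + (of_int (walk e n))\<^sup>2 - (of_int (walk e (Suc n)))\<^sup>2) / 8"
proof -
  have h: "h n = tilted_takagi v e n - of_int (walk e n) / 2" for n
    by (simp add: h_def tilted_takagi_def algebra_simps)
  show ?thesis
    using binary_orbitD(3)[OF assms(1), of n]
    unfolding h tilted_takagi_step[OF assms(1), of n] walk_Suc
    by (elim disjE) (simp_all add: field_simps power2_eq_square)
qed

text \<open>The difference of the two centered functions obeys a homogeneous halving recursion and
  grows at most linearly, so it vanishes. At time \<open>0\<close> the walk is zero and only the
  Takagi values remain.\<close>

lemma takagi_eq_if_abs_walk_eq:
  assumes "binary_orbit v e" "binary_orbit v' e'" "\<And>n. \<bar>walk e n\<bar> = \<bar>walk e' n\<bar>"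
  shows "takagi (v 0) = takagi (v' 0)"
proof -
  have le: "takagi (u 0) \<le> takagi (w 0)"
    if u: "binary_orbit u d" and w: "binary_orbit w c"
      and abs: "\<And>n. \<bar>walk d n\<bar> = \<bar>walk c n\<bar>" for u w d c
  proof -
    define h where "h u d n = takagi (u n) + of_int (walk d n) * (u n - 1 / 2)" for u d n
    have sq: "(of_int (walk d n) :: real)\<^sup>2 = (of_int (walk c n))\<^sup>2" for n
      by (metis abs of_int_power power2_abs)
    have bound: "\<bar>of_int (walk d n) * (u n - 1 / 2)\<bar> \<le> real n"
      if "binary_orbit u d" for u d n
    proof -
      have "\<bar>of_int (walk d n) * (u n - 1 / 2)\<bar> \<le> real n * 1"
        unfolding abs_mult
        using walk_bound[of d n] binary_orbitD(1,2)[OF that, of n]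
        by (intro mult_mono) (linarith | simp)+
      then show ?thesis by simp
    qed
    have "h u d 0 - h w c 0 \<le> 0"
    proof (rule nonpos_if_le_half_next[where g = "\<lambda>n. h u d n - h w c n" and C = 2])
      show "h u d n - h w c n \<le> (h u d (Suc n) - h w c (Suc n)) / 2" for n
        unfolding h_def centered_takagi_step[OF u, of n] centered_takagi_step[OF w, of n] sq
        by (simp add: field_simps)
      show "h u d n - h w c n \<le> 2 * (real n + 1)" for n
      proof -
        have "h u d n \<le> 1 + real n"
          unfolding h_def using bound[OF u, of n]
          by (intro add_mono takagi_bounds) (simp only: abs_le_iff)
        moreover have "0 + - real n \<le> h w c n"
          unfolding h_def using bound[OF w, of n]
          by (intro add_mono takagi_bounds) (simp only: abs_le_iff minus_le_iff)
        ultimately show ?thesis by simp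
      qed
    qed
    then show ?thesis by (simp add: h_def)
  qed
  show ?thesis
    using le[OF assms] le[OF assms(2,1)] assms(3) by fastforce
qed


section \<open>Injectivity on points with positive walk\<close>

text \<open>The difference of the two sides is halved exactly when the digit is 1; when it is 0
  there is an extra term \<open>(1 - walk e n) / 2\<close>, nonpositive because the walk is at least
  1.\<close>

lemma tilted_takagi_le_walk:
  assumes o: "binary_orbit v e" and pos: "\<And>n. n \<ge> 1 \<Longrightarrow> walk e n \<ge> 1" and "n \<ge> 1"
  shows "tilted_takagi v e n \<le> of_int (walk e n)"
proof -
  \<comment> \<open>The index is shifted by one because the walk is 0, not positive, at time
    \<open>0\<close>.\<close>
  define g where "g n = tilted_takagi v e (Suc n) - of_int (walk e (Suc n))" for n
  have "g n \<le> 0" for n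
  proof (rule nonpos_if_le_half_next[where C = 1])
    show "g n \<le> g (Suc n) / 2" for n
      using pos[of "Suc n"] binary_orbitD(3)[OF o, of "Suc n"]
      unfolding g_def tilted_takagi_step[OF o, of "Suc n"] walk_Suc[of e "Suc n"]
      by (elim disjE) (simp_all add: field_simps)
    show "g n \<le> 1 * (real n + 1)" for n
    proof -
      have "of_int (walk e (Suc n)) * v (Suc n) \<le> of_int (walk e (Suc n)) * 1"
        using pos[of "Suc n"] binary_orbitD(2)[OF o, of "Suc n"] by (intro mult_left_mono) auto
      then show ?thesis
        using takagi_bounds(2)[of "v (Suc n)"] unfolding g_def tilted_takagi_def by simp
    qed
  qed
  from this[of "n - 1"] show ?thesis
    using \<open>n \<ge> 1\<close> by (simp add: g_def)
qed

text \<open>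
  At the first index \<open>k\<close> where the digits differ, \<open>(D\<^sub>k + 1) / 2\<close> separates the two values of
  \<^const>\<open>tilted_takagi\<close>.
\<close>

lemma takagi_less_if_positive_walk:
  assumes o: "binary_orbit v e" "binary_orbit v' e'"
    and pos: "\<And>n. n \<ge> 1 \<Longrightarrow> walk e n \<ge> 1" "\<And>n. n \<ge> 1 \<Longrightarrow> walk e' n \<ge> 1"
    and nz: "v' (Suc k) > 0"
    and eq: "\<And>j. j < k \<Longrightarrow> e j = e' j" and k: "e k = 0" "e' k = 1"
  shows "takagi (v 0) < takagi (v' 0)"
proof -
  have w: "walk e k = walk e' k"
    by (rule walk_cong) (rule eq)
  have "tilted_takagi v e (Suc k) \<le> of_int (walk e k) + 1"
    using tilted_takagi_le_walk[OF o(1) pos(1), of "Suc k"] k by (simp add: walk_Suc)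
  \<comment> \<open>Strictness of the final inequality comes from this side.\<close>
  moreover have "tilted_takagi v' e' (Suc k) > 0"
  proof -
    have "of_int (walk e' (Suc k)) * v' (Suc k) > 0"
      using pos(2)[of "Suc k"] nz by (intro mult_pos_pos) auto
    then show ?thesis
      using takagi_bounds(1)[of "v' (Suc k)"] unfolding tilted_takagi_def by simp
  qed
  ultimately have "tilted_takagi v e k < tilted_takagi v' e' k"
    using k w unfolding tilted_takagi_step[OF o(1), of k] tilted_takagi_step[OF o(2), of k]
    by (simp add: field_simps)
  then have "(tilted_takagi v e k - tilted_takagi v' e' k) / 2 ^ k < 0"
    by (simp add: divide_neg_pos)
  with tilted_takagi_diff[of v e v' e' k, OF o eq] have "tilted_takagi v e 0 < tilted_takagi v' e' 0"
    by simp
  then show ?thesis by (simp add: tilted_takagi_def)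
qed

lemma digits_eq_if_positive_walk:
  assumes o: "binary_orbit v e" "binary_orbit v' e'"
    and pos: "\<And>n. n \<ge> 1 \<Longrightarrow> walk e n \<ge> 1" "\<And>n. n \<ge> 1 \<Longrightarrow> walk e' n \<ge> 1"
    and nz: "\<And>n. v n > 0" "\<And>n. v' n > 0"
    and T: "takagi (v 0) = takagi (v' 0)"
  shows "e = e'"
proof (rule ccontr)
  assume "e \<noteq> e'"
  then have ex: "\<exists>k. e k \<noteq> e' k" by auto
  define k where "k = (LEAST k. e k \<noteq> e' k)"
  have k: "e k \<noteq> e' k" and less: "\<And>j. j < k \<Longrightarrow> e j = e' j"
    unfolding k_def using LeastI_ex[OF ex] not_less_Least by blast+
  consider "e k = 0" "e' k = 1" | "e k = 1" "e' k = 0"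
    using k binary_orbitD(3)[OF o(1), of k] binary_orbitD(3)[OF o(2), of k] by auto
  then show False
  proof cases
    case 1
    then show ?thesis
      using takagi_less_if_positive_walk[OF o pos nz(2) less] T by simp
  next
    case 2
    then show ?thesis
      using takagi_less_if_positive_walk[OF o(2,1) pos(2,1) nz(1) less[symmetric]] T by simp
  qed
qed

text \<open>If the first digit is 1 the walks are negative. The reflection
  \<open>v \<mapsto> 1 - v\<close> makes them positive and preserves Takagi values, since it
  preserves the modulus of the walk.\<close>

lemma digits_eq_if_nonzero_walk:
  assumes o: "binary_orbit v e" "binary_orbit v' e'"
    and walk: "\<And>n. n \<ge> 1 \<Longrightarrow> walk e n \<noteq> 0" "\<And>n. n \<ge> 1 \<Longrightarrow> walk e' n \<noteq> 0"
    and v: "\<And>n. v n \<in> {0<..<1}" "\<And>n. v' n \<in> {0<..<1}"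
    and T: "takagi (v 0) = takagi (v' 0)" and e0: "e 0 = e' 0"
  shows "e = e'"
proof (cases "e 0 = 0")
  case True
  show ?thesis
  proof (rule digits_eq_if_positive_walk[OF o _ _ _ _ T])
    show "walk e n \<ge> 1" "walk e' n \<ge> 1" if "n \<ge> 1" for n
      using that walk True e0 by (auto intro!: walk_positive)
  qed (use v in auto)
next
  case False
  note e01 = binary_orbitD(3)[OF o(1)] binary_orbitD(3)[OF o(2)]
  note r = binary_orbit_reflect[OF o(1)] binary_orbit_reflect[OF o(2)]
  note wr = walk_reflect[of e, OF e01(1)] walk_reflect[of e', OF e01(2)]
  have "takagi (1 - v 0) = takagi (v 0)"
    by (rule takagi_eq_if_abs_walk_eq[OF r(1) o(1)]) (simp only: wr abs_minus_cancel)
  moreover have "takagi (1 - v' 0) = takagi (v' 0)"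
    by (rule takagi_eq_if_abs_walk_eq[OF r(2) o(2)]) (simp only: wr abs_minus_cancel)
  ultimately have T': "takagi (1 - v 0) = takagi (1 - v' 0)"
    using T by simp
  have "(\<lambda>k. 1 - e k) = (\<lambda>k. 1 - e' k)"
  proof (rule digits_eq_if_positive_walk[OF r _ _ _ _ T'])
    show "walk (\<lambda>k. 1 - e k) n \<ge> 1" if "n \<ge> 1" for n
      by (rule walk_positive[OF _ _ that]) (use False e01(1)[of 0] walk wr in auto)
    show "walk (\<lambda>k. 1 - e' k) n \<ge> 1" if "n \<ge> 1" for n
      by (rule walk_positive[OF _ _ that]) (use False e0 e01(1)[of 0] walk wr in auto)
  qed (use v in auto)
  show ?thesis
  proof
    fix n
    \<comment> \<open>Truncated subtraction from 1 is injective on the digits 0 and 1.\<close>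
    have "1 - e n = 1 - e' n"
      using \<open>(\<lambda>k. 1 - e k) = (\<lambda>k. 1 - e' k)\<close> by (rule fun_cong)
    then show "e n = e' n"
      using e01(1)[of n] e01(2)[of n] by auto
  qed
qed


section \<open>Points whose walk returns to zero finitely often\<close>

lemma binary_orbit_frac:
  assumes "x \<in> {0..<1}"
  shows "binary_orbit (\<lambda>n. frac (2 ^ n * x)) (\<lambda>n. binary_digit x (Suc n))"
proof -
  note b = binary_expansion_binary_digit[OF assms]
  have "2 * frac (2 ^ n * x) = real (binary_digit x (Suc n)) + frac (2 ^ Suc n * x)" for n
  proof -
    have "int (binary_digit x (Suc n)) = \<lfloor>2 ^ Suc n * x\<rfloor> mod 2"
      by (rule binary_expansion_floor[OF assms b]) simp
    moreover have *: "2 ^ Suc n * x = 2 * (2 ^ n * x)" by simp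
    have "\<lfloor>2 * (2 ^ n * x)\<rfloor> = 2 * \<lfloor>2 ^ n * x\<rfloor> \<or> \<lfloor>2 * (2 ^ n * x)\<rfloor> = 2 * \<lfloor>2 ^ n * x\<rfloor> + 1"
      by linarith
    ultimately have "\<lfloor>2 ^ Suc n * x\<rfloor> = 2 * \<lfloor>2 ^ n * x\<rfloor> + int (binary_digit x (Suc n))"
      unfolding * by auto
    then show ?thesis
      unfolding frac_def by simp
  qed
  moreover have "binary_digit x (Suc n) \<in> {0, 1}" for n
    using b by (simp add: binary_expansion_def)
  ultimately show ?thesis
    unfolding binary_orbit_def by (simp add: less_imp_le[OF frac_lt_1])
qed

lemma digit_walk_eq_walk: "digit_walk n x = walk (\<lambda>n. binary_digit x (Suc n)) n"
  by (simp add: digit_walk_def walk_def sum.atLeast1_atMost_eq)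

lemma takagi_eq_if_takagi_equiv:
  assumes "x \<in> {0..<1}" "x' \<in> {0..<1}" "takagi_equiv x x'"
  shows "takagi x = takagi x'"
proof -
  \<comment> \<open>\<open>takagi_equiv\<close> starts at index 1; at index \<open>0\<close> both
    walks are empty sums.\<close>
  have "\<bar>digit_walk n x\<bar> = \<bar>digit_walk n x'\<bar>" for n
    using assms(3) unfolding takagi_equiv_def by (cases n) (auto simp: digit_walk_def)
  then have "takagi (frac (2 ^ 0 * x)) = takagi (frac (2 ^ 0 * x'))"
    by (intro takagi_eq_if_abs_walk_eq[OF binary_orbit_frac[OF assms(1)] binary_orbit_frac[OF assms(2)]])
      (simp add: digit_walk_eq_walk)
  then show ?thesis
    using assms(1,2) by (simp add: frac_eq)
qed

lemma frac_pos_if_not_dyadic: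
  fixes x :: real
  assumes "x \<ge> 0" "x \<notin> dyadics"
  shows "frac (2 ^ n * x) > 0"
proof (rule ccontr)
  assume "\<not> ?thesis"
  then have "frac (2 ^ n * x) = 0"
    using frac_ge_0[of "2 ^ n * x"] by linarith
  then have "2 ^ n * x = of_int \<lfloor>2 ^ n * x\<rfloor>"
    by (simp add: frac_def)
  moreover have "\<lfloor>2 ^ n * x\<rfloor> \<ge> 0"
    using assms(1) by simp
  ultimately have "2 ^ n * x = of_nat (nat \<lfloor>2 ^ n * x\<rfloor>)"
    by simp
  then have "x = of_nat (nat \<lfloor>2 ^ n * x\<rfloor>) / 2 ^ n"
    by (simp add: field_simps)
  then show False
    using assms(2) unfolding dyadics_def by blast
qed

lemma countable_dyadics: "countable (dyadics :: real set)"
  unfolding dyadics_def by (intro countable_UN) auto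

lemma countable_last_return:
  "countable {x \<in> {0..<1} - dyadics. takagi x = y \<and> digit_walk n x = 0 \<and>
     (\<forall>j>n. digit_walk j x \<noteq> 0)}" (is "countable ?S")
proof -
  define d where "d x = (\<lambda>n. binary_digit x (Suc n))" for x
  \<comment> \<open>The extra digit \<open>d x n\<close> records the sign of the walk after its last
    return.\<close>
  define f where "f x = (map (d x) [0..<n], d x n)" for x
  have "inj_on f ?S"
  proof (rule inj_onI)
    fix x x'
    assume x: "x \<in> ?S" and x': "x' \<in> ?S" and f: "f x = f x'"
    define v where "v x = (\<lambda>n. frac (2 ^ n * x))" for x :: real
    have in01: "x \<in> {0..<1}" "x' \<in> {0..<1}"
      using x x' by auto
    have o: "binary_orbit (v x) (d x)" "binary_orbit (v x') (d x')"
      unfolding v_def d_def using in01 by (intro binary_orbit_frac; simp)+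
    have v0: "v x 0 = x" "v x' 0 = x'"
      using in01 by (simp_all add: v_def frac_eq)
    have prefix: "d x j = d x' j" if "j < n" for j
      using f that unfolding f_def by (auto simp: map_eq_conv)
    have w: "walk (d x) n = 0" "walk (d x') n = 0"
      "\<And>j. j > n \<Longrightarrow> walk (d x) j \<noteq> 0" "\<And>j. j > n \<Longrightarrow> walk (d x') j \<noteq> 0"
      using x x' by (auto simp: digit_walk_eq_walk d_def)
    have "tilted_takagi (v x) (d x) 0 - tilted_takagi (v x') (d x') 0 = 0"
      using x x' v0 by (simp add: tilted_takagi_def)
    then have "tilted_takagi (v x) (d x) n - tilted_takagi (v x') (d x') n = 0"
      using tilted_takagi_diff[OF o prefix] by simp
    \<comment> \<open>The tilt vanishes at a return time, so equal Takagi values at time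
      \<open>0\<close> carry over to time \<open>n\<close>.\<close>
    then have T: "takagi (v x (n + 0)) = takagi (v x' (n + 0))"
      using w(1,2) by (simp add: tilted_takagi_def)
    have "(\<lambda>k. d x (n + k)) = (\<lambda>k. d x' (n + k))"
    proof (rule digits_eq_if_nonzero_walk[where v = "\<lambda>k. v x (n + k)" and v' = "\<lambda>k. v x' (n + k)"])
      show "takagi (v x (n + 0)) = takagi (v x' (n + 0))" by (rule T)
      show "v x (n + k) \<in> {0<..<1}" "v x' (n + k) \<in> {0<..<1}" for k
        using frac_pos_if_not_dyadic x x' by (auto simp: v_def frac_lt_1)
      show "d x (n + 0) = d x' (n + 0)"
        using f by (simp add: f_def)
    qed (use w o in \<open>auto simp: walk_shift intro: binary_orbit_shift\<close>)
    then have suffix: "d x (n + k) = d x' (n + k)" for k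
      by (rule fun_cong)
    have "d x j = d x' j" for j
      using prefix[of j] suffix[of "j - n"] by (cases "j < n") simp_all
    then have "d x = d x'" by (rule ext)
    then show "x = x'"
      using binary_orbit_unique[of "v x" "d x" "v x'"] o v0 by simp
  qed
  then show ?thesis
    by (rule countableI')
qed

lemma countable_finitely_many_returns:
  "countable {x \<in> {0..<1} - dyadics. takagi x = y \<and> finite {k. digit_walk k x = 0}}"
proof (rule countable_subset)
  let ?S = "\<lambda>n. {x \<in> {0..<1} - dyadics. takagi x = y \<and> digit_walk n x = 0 \<and>
     (\<forall>j>n. digit_walk j x \<noteq> 0)}"
  show "countable (\<Union>n. ?S n)"
    by (rule countable_UN[OF countableI_type countable_last_return])
  show "{x \<in> {0..<1} - dyadics. takagi x = y \<and> finite {k. digit_walk k x = 0}} \<subseteq> (\<Union>n. ?S n)"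
  proof
    fix x
    assume x: "x \<in> {x \<in> {0..<1} - dyadics. takagi x = y \<and> finite {k. digit_walk k x = 0}}"
    define Z where "Z = {k. digit_walk k x = 0}"
    define m where "m = Max Z"
    \<comment> \<open>Time \<open>0\<close> counts as a return, so a last return exists.\<close>
    have fin: "finite Z" and "0 \<in> Z"
      using x by (simp_all add: Z_def digit_walk_def)
    then have "m \<in> Z"
      unfolding m_def by (intro Max_in) auto
    moreover have "j \<notin> Z" if "j > m" for j
      using Max_ge[OF fin] that by (auto simp: m_def not_le[symmetric])
    ultimately have "x \<in> ?S m"
      using x by (simp add: Z_def)
    then show "x \<in> (\<Union>n. ?S n)" by (rule UN_I[OF UNIV_I])
  qed
qed


section \<open>Flipping excursions of a recurrent walk\<close>

text \<open>Under a constant digit the walk is strictly monotone and cannot vanish twice.\<close>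

lemma recurrent_walk_not_eventually_constant:
  assumes "infinite {k. walk e k = 0}" and const: "\<And>n. n \<ge> N \<Longrightarrow> e n = c"
  shows False
proof -
  have ex: "\<exists>k>m. walk e k = 0" for m
    using assms(1) unfolding infinite_nat_iff_unbounded by blast
  obtain m where m: "m > N" "walk e m = 0" using ex by blast
  obtain k where k: "k > m" "walk e k = 0" using ex by blast
  have "walk e (m + i) = int i * (- 1) ^ c" for i
    by (induction i) (use m const in \<open>auto simp: walk_Suc algebra_simps\<close>)
  from this[of "k - m"] k show False by simp
qed

text \<open>An orbit at 0 or 1 is forced to stay there and to repeat the digit 0 or 1
  respectively.\<close>

lemma binary_orbit_const_from:
  assumes "binary_orbit v e" "v k \<in> \<int>" "n \<ge> k"
  shows "real (e n) = v k \<and> v n = v k"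
  using assms(3)
proof (induction n rule: dec_induct)
  case base
  note o = binary_orbitD[OF assms(1)]
  have "v k = 0 \<or> v k = 1"
    using assms(2) o(1,2)[of k] by (auto elim!: Ints_cases)
  then show ?case
    using o(3,4)[of k] o(1,2)[of "Suc k"] by auto
next
  case (step n)
  note o = binary_orbitD[OF assms(1)]
  have "v k = 0 \<or> v k = 1"
    using assms(2) o(1,2)[of k] by (auto elim!: Ints_cases)
  then show ?case
    using step.IH o(3,4)[of n] o(3,4)[of "Suc n"] o(1,2)[of "Suc n"] o(1,2)[of "Suc (Suc n)"]
    by auto
qed

lemma binary_orbit_exists:
  assumes "\<And>n. e n = 0 \<or> e n = 1"
  obtains v where "binary_orbit v e" "(\<lambda>j. real (e j) / 2 ^ Suc j) sums v 0"
proof -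
  define t where "t n j = real (e (n + j)) / 2 ^ Suc j" for n j
  \<comment> \<open>\<open>v n\<close> is the value of the digit sequence read from index
    \<open>n\<close> on.\<close>
  define v where "v n = (\<Sum>j. t n j)" for n
  have t: "0 \<le> t n j" "t n j \<le> (1 / 2) ^ Suc j" for n j
    using assms[of "n + j"] by (auto simp: t_def field_simps)
  have summ: "summable (t n)" for n
    by (rule summable_comparison_test'[OF sums_summable[OF power_half_series]])
      (use t in auto)
  have "0 \<le> v n" for n
    unfolding v_def by (intro suminf_nonneg summ t)
  moreover have "v n \<le> 1" for n
  proof -
    have "v n \<le> (\<Sum>j. (1 / 2) ^ Suc j)"
      unfolding v_def by (intro suminf_le summ t sums_summable[OF power_half_series])
    then show ?thesis
      using sums_unique[OF power_half_series] by simp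
  qed
  moreover have "2 * v n = real (e n) + v (Suc n)" for n
  proof -
    have "v n = t n 0 + (\<Sum>j. t n (Suc j))"
      unfolding v_def using suminf_split_head[OF summ[of n]] by simp
    also have "(\<Sum>j. t n (Suc j)) = (\<Sum>j. t (Suc n) j / 2)"
      by (simp add: t_def)
    also have "\<dots> = v (Suc n) / 2"
      unfolding v_def by (rule suminf_divide[OF summ])
    finally show ?thesis by (simp add: t_def)
  qed
  ultimately have "binary_orbit v e"
    using assms by (auto simp: binary_orbit_def)
  moreover have "(\<lambda>j. real (e j) / 2 ^ Suc j) sums v 0"
    using summable_sums[OF summ[of 0]] unfolding v_def t_def by simp
  ultimately show ?thesis by (rule that)
qed

lemma binary_orbit_iterate:
  assumes "binary_orbit v e"
  shows "2 ^ k * v 0 - v k \<in> \<int>"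
proof (induction k)
  case (Suc k)
  have "2 ^ Suc k * v 0 - v (Suc k) = 2 * (2 ^ k * v 0 - v k) + of_int (int (e k))"
    using binary_orbitD(4)[OF assms, of k] by (simp add: algebra_simps)
  then show ?case
    using Suc by (metis Ints_add Ints_mult Ints_numeral Ints_of_int)
qed simp

text \<open>The value of the digit series could have another chosen expansion only if it were
  dyadic; its orbit would then reach an integer and the digits would become constant, contradicting
  recurrence.\<close>

lemma recurrent_walk_realized:
  assumes e: "\<And>n. e n = 0 \<or> e n = 1" and inf: "infinite {k. walk e k = 0}"
  obtains x where "x \<in> {0..<1}" "\<And>n. binary_digit x (Suc n) = e n"
proof -
  obtain v where v: "binary_orbit v e" "(\<lambda>j. real (e j) / 2 ^ Suc j) sums v 0"
    by (rule binary_orbit_exists[of e, OF e])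
  have nd: "v 0 \<notin> dyadics"
  proof
    assume "v 0 \<in> dyadics"
    then obtain k m :: nat where km: "v 0 = of_nat m / 2 ^ k"
      by (auto simp: dyadics_def)
    then have "2 ^ k * v 0 = of_nat m" by simp
    then have "of_nat m - v k \<in> \<int>"
      using binary_orbit_iterate[OF v(1), of k] by simp
    then have "of_nat m - (of_nat m - v k) \<in> \<int>"
      by (intro Ints_diff) auto
    then have "v k \<in> \<int>" by simp
    then have "e n = e k" if "n \<ge> k" for n
      using binary_orbit_const_from[OF v(1) _ that] binary_orbit_const_from[OF v(1) _ order_refl]
      by (metis of_nat_eq_iff)
    then show False
      by (rule recurrent_walk_not_eventually_constant[OF inf])
  qed
  have "v 0 \<noteq> 1"
    using nd real_in_dyadics[of 1] by auto
  then have x: "v 0 \<in> {0..<1}"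
    using binary_orbitD(1,2)[OF v(1), of 0] by auto
  \<comment> \<open>Expansion digits start at index 1; the value that \<open>n - 1\<close> gives at
    index 0 is irrelevant.\<close>
  have b: "binary_expansion (v 0) (\<lambda>n. e (n - 1))"
    unfolding binary_expansion_def using e v(2) nd by auto
  have "binary_digit (v 0) (Suc n) = e n" for n
    using binary_expansion_unique[OF x binary_expansion_binary_digit[OF x] b, of "Suc n"] by simp
  with x show ?thesis by (rule that)
qed

text \<open>Labels the step from time \<open>n\<close> to \<open>n + 1\<close> by the starting time
  of its excursion.\<close>

fun last_return :: "(nat \<Rightarrow> nat) \<Rightarrow> nat \<Rightarrow> nat" where
  "last_return e 0 = 0"
| "last_return e (Suc n) = (if walk e (Suc n) = 0 then Suc n else last_return e n)"

definition flip_excursions :: "nat set \<Rightarrow> (nat \<Rightarrow> nat) \<Rightarrow> nat \<Rightarrow> nat" where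
  "flip_excursions S e n = (if last_return e n \<in> S then 1 - e n else e n)"

lemma last_return_at_zero: "walk e n = 0 \<Longrightarrow> last_return e n = n"
  by (cases n) auto

text \<open>The label changes only at zeros of the walk, where both signs agree.\<close>

lemma walk_flip_excursions:
  assumes "\<And>n. e n = 0 \<or> e n = 1"
  shows "walk (flip_excursions S e) n = (if last_return e n \<in> S then - walk e n else walk e n)"
proof (induction n)
  case (Suc n)
  then show ?case
    using assms[of n] by (auto simp: walk_Suc flip_excursions_def)
qed simp

text \<open>A return time is its own label, so the digit there reveals whether its excursion was
  flipped.\<close>

lemma flip_excursions_inj:
  assumes e: "\<And>n. e n = 0 \<or> e n = 1" and S: "S \<subseteq> {k. walk e k = 0}" "S' \<subseteq> {k. walk e k = 0}"
    and eq: "flip_excursions S e = flip_excursions S' e"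
  shows "S = S'"
proof -
  have "k \<in> S \<longleftrightarrow> k \<in> S'" if "walk e k = 0" for k
    using fun_cong[OF eq, of k] e[of k]
    by (auto simp: flip_excursions_def last_return_at_zero[OF that] split: if_splits)
  then show ?thesis using S by blast
qed

text \<open>If \<open>Pow A\<close> were countable, then so would be \<open>A\<close>; composing
  enumerations would map \<open>A\<close> onto \<open>Pow A\<close>, against Cantor.\<close>

lemma uncountable_Pow_infinite:
  assumes "infinite A"
  shows "uncountable (Pow A)"
proof
  assume c: "countable (Pow A)"
  have "(\<lambda>x. {x}) ` A \<subseteq> Pow A" by auto
  then have "countable ((\<lambda>x. {x}) ` A)"
    using c countable_subset by blast
  then have "countable A"
    by (rule countable_image_inj_on) auto
  then have A: "to_nat_on A ` A = UNIV"
    using assms to_nat_on_infinite bij_betw_imp_surj_on by blast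
  have "range (from_nat_into (Pow A)) = Pow A"
    using c by (intro range_from_nat_into) auto
  then have "(from_nat_into (Pow A) \<circ> to_nat_on A) ` A = Pow A"
    unfolding image_comp[symmetric] A .
  then show False
    using Cantors_theorem by blast
qed

lemma uncountable_local_level_set:
  assumes x: "x \<in> {0..<1}" and inf: "infinite {k. digit_walk k x = 0}"
  shows "uncountable (local_level_set x)"
proof -
  define e where "e = (\<lambda>n. binary_digit x (Suc n))"
  have walk: "digit_walk n x = walk e n" for n
    by (simp add: digit_walk_eq_walk e_def)
  have e: "e n = 0 \<or> e n = 1" for n
    using binary_orbitD(3)[OF binary_orbit_frac[OF x]] by (simp add: e_def)
  have flip: "flip_excursions S e n = 0 \<or> flip_excursions S e n = 1" for S n
    using e[of n] by (auto simp: flip_excursions_def)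
  have abs: "\<bar>walk (flip_excursions S e) n\<bar> = \<bar>walk e n\<bar>" for S n
    by (simp add: walk_flip_excursions[OF e])
  \<comment> \<open>Flipping keeps the zeros, so every flipped sequence is again realized by a
    point.\<close>
  have "infinite {k. walk (flip_excursions S e) k = 0}" for S
  proof -
    have "walk (flip_excursions S e) k = 0 \<longleftrightarrow> walk e k = 0" for k
      using abs[of S k] by linarith
    then show ?thesis
      using inf unfolding walk by simp
  qed
  then have "\<exists>x'. x' \<in> {0..<1} \<and> (\<forall>n. binary_digit x' (Suc n) = flip_excursions S e n)" for S
    by (rule recurrent_walk_realized[OF flip]) blast
  then have "\<exists>g. \<forall>S. g S \<in> {0..<1} \<and> (\<forall>n. binary_digit (g S) (Suc n) = flip_excursions S e n)"
    by (intro choice allI)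
  then obtain g where g: "\<And>S. g S \<in> {0..<1}"
    "\<And>S n. binary_digit (g S) (Suc n) = flip_excursions S e n"
    by blast
  let ?Z = "{k. walk e k = 0}"
  have "inj_on g (Pow ?Z)"
  proof (rule inj_onI)
    fix S S'
    assume S: "S \<in> Pow ?Z" "S' \<in> Pow ?Z" and "g S = g S'"
    then have "flip_excursions S e = flip_excursions S' e"
      using g(2) by (metis ext)
    then show "S = S'"
      using flip_excursions_inj[of e S S'] e S by blast
  qed
  moreover have "g ` Pow ?Z \<subseteq> local_level_set x"
  proof -
    have "digit_walk n (g S) = walk (flip_excursions S e) n" for S n
      by (simp add: digit_walk_eq_walk g(2))
    then show ?thesis
      using g(1) by (auto simp: local_level_set_def takagi_equiv_def walk abs)
  qed
  ultimately show ?thesis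
    using uncountable_Pow_infinite[of ?Z] inf unfolding walk
    by (meson countable_image_inj_on countable_subset)
qed

theorem theorem7:
  fixes y :: real
  assumes "uncountable (takagi_level_set y)"
  shows "\<exists>x\<in>{0..<1}. uncountable (local_level_set x) \<and> local_level_set x \<subseteq> takagi_level_set y"
proof -
  \<comment> \<open>The exceptional points, namely \<open>?F\<close>, the dyadics and the endpoint
    1, are countably many and cannot exhaust the level set.\<close>
  let ?F = "{x \<in> {0..<1} - dyadics. takagi x = y \<and> finite {k. digit_walk k x = 0}}"
  have c: "countable (?F \<union> dyadics \<union> {1})"
    by (intro countable_Un countable_finitely_many_returns countable_dyadics) simp
  have "\<not> takagi_level_set y \<subseteq> ?F \<union> dyadics \<union> {1}"
    using assms countable_subset[OF _ c] by (rule contrapos_nn)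
  then obtain x where x: "x \<in> takagi_level_set y" "x \<notin> ?F" "x \<notin> dyadics" "x \<noteq> 1"
    by blast
  then have x: "x \<in> {0..<1}" "takagi x = y" "infinite {k. digit_walk k x = 0}"
    by (simp_all add: takagi_level_set_def)
  have "local_level_set x \<subseteq> takagi_level_set y"
    using takagi_eq_if_takagi_equiv x(1,2)
    by (force simp: local_level_set_def takagi_level_set_def)
  with x(1) uncountable_local_level_set[OF x(1,3)] show ?thesis by blast
qed

end
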